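(* Let $A_0,\dots,A_n\in\mathcal S^p$ be such that the system $\mathcal A(\mathbf x)\in\mathcal{COP}^p$ is consistent. The condition A1) the set $L:=\mathrm{cone}\{\mathbf a(\mathbf t):\mathbf t\in T_{im}\}$ is a (linear) subspace is equivalent to the following condition: A2) there exists a matrix $U^*\in\mathcal{CP}^p$ of the form $$U^*=\sum_{i\in I}\alpha_i\mathbf t(i)\mathbf t(i)^\top+\frac14\sum_{(l,q)\in V_0}(\boldsymbol\tau(l)+\boldsymbol\tau(q))(\boldsymbol\tau(l)+\boldsymbol\tau(q))^\top,\quad \alpha_i>0,\ \mathbf t(i)\in T_{im},\ i\in I,\ |I|<\infty,$$ such that $A_m\bullet U^*=0$ for all $m=0,1,\dots,n$.
   Context: Fix integers $p>1$, $n\ge 1$. $\mathcal S^p$ is the space of real symmetric $p\times p$ matrices with $A\bullet B=\mathrm{trace}(AB)$; $\mathbf e_1,\dots,\mathbf e_p$ is the standard basis of $\mathbb R^p$; $\mathbb R^p_+$ is the set of vectors with non-negative components; $P=\{1,\dots,p\}$; $T=\{\mathbf t\in\mathbb R^p_+:\sum_{k\in P} t_k=1\}$; $\mathcal{COP}^p=\{D\in\mathcal S^p:\mathbf t^\top D\mathbf t\ge 0\ \forall \mathbf t\in\mathbb R^p_+\}$; $\mathcal{CP}^p=\mathrm{conv}\{\mathbf t\mathbf t^\top:\mathbf t\in\mathbb R^p_+\}$. For a set $\mathcal B$, $\mathrm{cone}\,\mathcal B$ is the set of all finite linear combinations of elements of $\mathcal B$ with non-negative coefficients (so $\mathrm{cone}\,\emptyset=\{0\}$).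 Given $A_0,\dots,A_n\in\mathcal S^p$, put $\mathcal A(\mathbf x)=A_0+\sum_{m=1}^n x_mA_m$ for $\mathbf x\in\mathbb R^n$ and $X=\{\mathbf x\in\mathbb R^n:\mathcal A(\mathbf x)\in\mathcal{COP}^p\}$. The system is consistent if $X\ne\emptyset$. $T_{im}=\{\mathbf t\in T:\mathbf t^\top\mathcal A(\mathbf x)\mathbf t=0\ \forall\mathbf x\in X\}$ is the set of normalized immobile indices; it is empty or a finite union of convex bounded polyhedra. $\{\boldsymbol\tau(j):j\in J\}$, $|J|<\infty$, is the set of vertices of $\mathrm{conv}\,T_{im}$ ($J=\emptyset$ if $T_{im}=\emptyset$). For $j\in J$: $M(j)=\{k\in P:\mathbf e_k^\top\mathcal A(\mathbf x)\boldsymbol\tau(j)=0\ \forall\mathbf x\in X\}$. For $\mathbf t\in T$: $\mathbf a(\mathbf t)=(\mathbf t^\top A_m\mathbf t)_{m=0,\dots,n}\in\mathbb R^{n+1}$. Subsets $J(s)\subset J$, $s\in S$ ($S$ finite; the subsets need not be disjoint) are fixed such that $T_{im}=\bigcup_{s\in S}T_{im}(s)$ with $T_{im}(s)=\mathrm{conv}\{\boldsymbol\tau(j):j\in J(s)\}$, and such that for every $s\in S$ the set $P_*(s)=\bigcup_{j\in J(s)}\{k\in P:\tau_k(j)>0\}$ satisfies $P_*(s)\subset M(j)$ for all $j\in J(s)$; it is known that such subsets exist. Numbering $J(s)=\{i_1,\dots,i_{k(s)}\}$, put $V(s)=\{(i_k,i_q):1\le k\le q\le k(s)\}$ and $V_0=\bigcup_{s\in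 S}V(s)$. *)

theory Defs
  imports "HOL-Analysis.Analysis"
begin

text \<open>The dimensions \<open>p\<close> and \<open>n\<close> are \<open>CARD('p)\<close> and \<open>CARD('n)\<close>.  A family of coefficient matrices
  \<open>A\<^sub>0, A\<^sub>1, \<dots>, A\<^sub>n\<close> is a function on \<open>'n option\<close>: \<open>A None\<close> is \<open>A\<^sub>0\<close> and \<open>A (Some m)\<close>,
  \<open>m :: 'n\<close>, are the matrices multiplied by the variables.  Accordingly \<open>\<real>\<^sup>n\<^sup>+\<^sup>1\<close> is
  \<open>real ^ 'n option\<close>.\<close>

definition sym_mats :: "(real ^ 'p ^ 'p) set" where
  "sym_mats = {D. transpose D = D}"

definition mat_inner :: "real ^ 'p ^ 'p \<Rightarrow> real ^ 'p ^ 'p \<Rightarrow> real" where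
  "mat_inner A B = trace (A ** B)"

definition outer :: "real ^ 'p \<Rightarrow> real ^ 'p ^ 'p" where
  "outer t = (\<chi> i j. t $ i * t $ j)"

definition nonneg_vecs :: "(real ^ 'p) set" where
  "nonneg_vecs = {t. \<forall>k. 0 \<le> t $ k}"

definition std_simplex :: "(real ^ 'p) set" where
  "std_simplex = {t \<in> nonneg_vecs. (\<Sum>k\<in>UNIV. t $ k) = 1}"

definition COP :: "(real ^ 'p ^ 'p) set" where
  "COP = {D \<in> sym_mats. \<forall>t\<in>nonneg_vecs. 0 \<le> t \<bullet> (D *v t)}"

definition CP :: "(real ^ 'p ^ 'p) set" where
  "CP = convex hull (outer ` nonneg_vecs)"

text \<open>All finite non-negative combinations, so that \<open>fin_cone {} = {0}\<close>.  The library's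
  \<open>cone hull\<close> and \<open>conic hull\<close> only close under non-negative scaling, not under addition.\<close>

definition fin_cone :: "'a::real_vector set \<Rightarrow> 'a set" where
  "fin_cone B = {(\<Sum>v\<in>F. c v *\<^sub>R v) | F c. finite F \<and> F \<subseteq> B \<and> (\<forall>v\<in>F. 0 \<le> c v)}"

definition mat_fun :: "('n::finite option \<Rightarrow> real ^ 'p ^ 'p) \<Rightarrow> real ^ 'n \<Rightarrow> real ^ 'p ^ 'p" where
  "mat_fun A x = A None + (\<Sum>m\<in>UNIV. x $ m *\<^sub>R A (Some m))"

definition feasible :: "('n::finite option \<Rightarrow> real ^ 'p ^ 'p) \<Rightarrow> (real ^ 'n) set" where
  "feasible A = {x. mat_fun A x \<in> COP}"

definition T_im :: "('n::finite option \<Rightarrow> real ^ 'p ^ 'p) \<Rightarrow> (real ^ 'p) set" where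
  "T_im A = {t \<in> std_simplex. \<forall>x\<in>feasible A. t \<bullet> (mat_fun A x *v t) = 0}"

text \<open>\<open>M_set A (\<tau> j)\<close> is the set \<open>M(j)\<close>.\<close>

definition M_set :: "('n::finite option \<Rightarrow> real ^ 'p ^ 'p) \<Rightarrow> real ^ 'p \<Rightarrow> 'p set" where
  "M_set A v = {k. \<forall>x\<in>feasible A. axis k 1 \<bullet> (mat_fun A x *v v) = 0}"

definition a_vec :: "('n::finite option \<Rightarrow> real ^ 'p ^ 'p) \<Rightarrow> real ^ 'p \<Rightarrow> real ^ 'n option" where
  "a_vec A t = (\<chi> m. t \<bullet> (A m *v t))"

text \<open>For a numbering \<open>is = [i\<^sub>1, \<dots>, i\<^sub>k]\<close> of \<open>J(s)\<close>, \<open>ordered_pairs is\<close> is \<open>V(s)\<close>.\<close>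

definition ordered_pairs :: "'j list \<Rightarrow> ('j \<times> 'j) set" where
  "ordered_pairs is = {(is ! k, is ! q) | k q. k \<le> q \<and> q < length is}"

end

theory Submission
  imports Defs
begin

text \<open>
  Both conditions speak about the linear map \<open>\<N> U = (A\<^sub>m \<bullet> U)\<^sub>m\<close> (here \<open>coeff_map A\<close>), since
  \<open>a(t) = \<N>(t t\<^sup>T)\<close>.  Write \<open>\<mu>(l,q) = (\<tau>(l) + \<tau>(q)) / 2\<close>; for \<open>(l,q)\<close> in \<open>V\<^sub>0\<close> both vertices belong to
  one convex piece of \<open>T\<^sub>i\<^sub>m\<close>, so \<open>\<mu>(l,q)\<close> is again an immobile index, and the second sum in \<open>U\<^sup>*\<close>
  is \<open>\<Sum> \<mu>(l,q) \<mu>(l,q)\<^sup>T\<close>.  Condition A2 therefore says that the vectors \<open>a(\<mu>(l,q))\<close>, each with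
  coefficient one, extend by further generators of \<open>L\<close> to a positive relation with sum zero.

  If \<open>L\<close> is a subspace, it contains \<open>- \<Sum> a(\<mu>(l,q))\<close>; writing this vector as a non-negative
  combination of generators gives the remaining summands of \<open>U\<^sup>*\<close>
  (\<open>fin_cone_image_positive\<close>).

  Conversely, a positive relation among elements of a convex cone puts the negative of each of its
  terms into the cone (\<open>neg_summand_in_convex_cone\<close>), so all \<open>a(\<mu>(l,q))\<close> lie in the lineality
  space of \<open>L\<close>.  These vectors already span everything: polarization recovers
  \<open>\<tau>(l) \<tau>(q)\<^sup>T + \<tau>(q) \<tau>(l)\<^sup>T\<close> from the matrices of the midpoints \<open>\<mu>(l,q)\<close>, \<open>\<mu>(l,l) = \<tau>(l)\<close> and
  \<open>\<mu>(q,q) = \<tau>(q)\<close>, and \<open>t t\<^sup>T\<close>, for \<open>t\<close> in the convex hull of the vertices of one piece, is a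
  combination of such symmetrized products (\<open>outer_in_span_outer_sums\<close>).  Hence every generator
  \<open>a(t)\<close> lies in the lineality space, which is then all of \<open>L\<close>.
\<close>

section \<open>Convex cones and their lineality spaces\<close>

lemma convex_cone_sum:
  assumes "convex_cone C" "\<And>i. i \<in> I \<Longrightarrow> f i \<in> C"
  shows "sum f I \<in> C"
  using assms(2)
proof (induction I rule: infinite_finite_induct)
  case (insert i I)
  then show ?case by (simp add: convex_cone_add[OF assms(1)])
qed (simp_all add: convex_cone_contains_0[OF assms(1)])

lemma subspace_lineality:
  assumes "convex_cone C"
  shows "subspace {v. v \<in> C \<and> - v \<in> C}"
proof (rule subspaceI)
  show "0 \<in> {v. v \<in> C \<and> - v \<in> C}"
    using convex_cone_contains_0[OF assms] by simp
next
  fix x y assume "x \<in> {v. v \<in> C \<and> - v \<in> C}" "y \<in> {v. v \<in> C \<and> - v \<in> C}"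
  then show "x + y \<in> {v. v \<in> C \<and> - v \<in> C}"
    using convex_cone_add[OF assms, of x y] convex_cone_add[OF assms, of "- x" "- y"] by simp
next
  fix x and c :: real assume x: "x \<in> {v. v \<in> C \<and> - v \<in> C}"
  show "c *\<^sub>R x \<in> {v. v \<in> C \<and> - v \<in> C}"
  proof (cases "c \<ge> 0")
    case True
    then show ?thesis
      using x convex_cone_scaleR[OF assms, of c x] convex_cone_scaleR[OF assms, of c "- x"] by simp
  next
    case False
    then show ?thesis
      using x convex_cone_scaleR[OF assms, of "- c" x] convex_cone_scaleR[OF assms, of "- c" "- x"]
      by simp
  qed
qed

text \<open>The negative of one term of a vanishing sum is the sum of the other terms.\<close>

lemma neg_summand_in_convex_cone:
  assumes "convex_cone C" "x \<in> C" "finite E" "\<And>e. e \<in> E \<Longrightarrow> f e \<in> C"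
    and "x + sum f E = 0" "e \<in> E"
  shows "- f e \<in> C"
proof -
  have "sum f E = f e + sum f (E - {e})"
    using assms(3,6) by (rule sum.remove)
  then have "- f e = x + sum f (E - {e})"
    using assms(5) by (simp add: neg_eq_iff_add_eq_0 algebra_simps)
  moreover have "sum f (E - {e}) \<in> C"
    using assms(4) by (intro convex_cone_sum[OF assms(1)]) simp
  ultimately show ?thesis
    by (simp add: convex_cone_add[OF assms(1,2)])
qed

lemma fin_coneI:
  assumes "finite F" "F \<subseteq> B" "\<And>v. v \<in> F \<Longrightarrow> 0 \<le> c v"
  shows "(\<Sum>v\<in>F. c v *\<^sub>R v) \<in> fin_cone B"
  using assms by (auto simp: fin_cone_def)

lemma subset_fin_cone: "B \<subseteq> fin_cone B"
proof
  fix b assume "b \<in> B"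
  then show "b \<in> fin_cone B"
    using fin_coneI[of "{b}" B "\<lambda>_. 1"] by simp
qed

lemma fin_cone_minimal:
  assumes "B \<subseteq> C" "convex_cone C"
  shows "fin_cone B \<subseteq> C"
proof
  fix x assume "x \<in> fin_cone B"
  then obtain F c where "finite F" "F \<subseteq> B" "\<forall>v\<in>F. 0 \<le> c v" "x = (\<Sum>v\<in>F. c v *\<^sub>R v)"
    by (auto simp: fin_cone_def)
  then show "x \<in> C"
    using assms by (auto intro!: convex_cone_sum convex_cone_scaleR)
qed

lemma convex_cone_fin_cone: "convex_cone (fin_cone B)"
proof (unfold convex_cone_iff, intro conjI ballI allI impI)
  show "0 \<in> fin_cone B"
    using fin_coneI[of "{}" B] by simp
next
  fix x y assume "x \<in> fin_cone B" "y \<in> fin_cone B"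
  then obtain F c G d where
    F: "finite F" "F \<subseteq> B" "\<forall>v\<in>F. 0 \<le> c v" "x = (\<Sum>v\<in>F. c v *\<^sub>R v)" and
    G: "finite G" "G \<subseteq> B" "\<forall>v\<in>G. 0 \<le> d v" "y = (\<Sum>v\<in>G. d v *\<^sub>R v)"
    unfolding fin_cone_def by blast
  define e where "e v = (if v \<in> F then c v else 0) + (if v \<in> G then d v else 0)" for v
  have "x = (\<Sum>v\<in>F \<union> G. (if v \<in> F then c v else 0) *\<^sub>R v)"
    unfolding F(4) using F(1) G(1) by (intro sum.mono_neutral_cong_left) auto
  moreover have "y = (\<Sum>v\<in>F \<union> G. (if v \<in> G then d v else 0) *\<^sub>R v)"
    unfolding G(4) using F(1) G(1) by (intro sum.mono_neutral_cong_left) auto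
  ultimately have "x + y = (\<Sum>v\<in>F \<union> G. e v *\<^sub>R v)"
    by (simp add: e_def scaleR_left_distrib sum.distrib)
  then show "x + y \<in> fin_cone B"
    using F G by (auto simp: e_def intro!: fin_coneI)
next
  fix x and r :: real assume "x \<in> fin_cone B" "0 \<le> r"
  then obtain F c where F: "finite F" "F \<subseteq> B" "\<forall>v\<in>F. 0 \<le> c v" "x = (\<Sum>v\<in>F. c v *\<^sub>R v)"
    by (auto simp: fin_cone_def)
  have "r *\<^sub>R x = (\<Sum>v\<in>F. (r * c v) *\<^sub>R v)"
    by (simp add: F(4) scaleR_sum_right)
  then show "r *\<^sub>R x \<in> fin_cone B"
    using F \<open>0 \<le> r\<close> by (auto intro!: fin_coneI)
qed

lemma subspace_fin_coneI:
  assumes "\<And>b. b \<in> B \<Longrightarrow> - b \<in> fin_cone B"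
  shows "subspace (fin_cone B)"
proof -
  let ?L = "{v. v \<in> fin_cone B \<and> - v \<in> fin_cone B}"
  have L: "subspace ?L"
    by (rule subspace_lineality[OF convex_cone_fin_cone])
  have "fin_cone B \<subseteq> ?L"
    using assms subset_fin_cone[of B]
    by (intro fin_cone_minimal subspace_imp_convex_cone[OF L]) auto
  then have "fin_cone B = ?L" by auto
  with L show ?thesis by simp
qed

text \<open>Terms with coefficient zero are dropped, the generators are replaced by preimages, and the
  finite index set is moved into the natural numbers.\<close>

lemma fin_cone_image_positive:
  assumes "x \<in> fin_cone (f ` T)"
  obtains I :: "nat set" and \<alpha> t where "finite I" "\<And>i. i \<in> I \<Longrightarrow> \<alpha> i > 0" "\<And>i. i \<in> I \<Longrightarrow> t i \<in> T"
    "x = (\<Sum>i\<in>I. \<alpha> i *\<^sub>R f (t i))"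
proof -
  obtain F c where F: "finite F" "F \<subseteq> f ` T" "\<forall>v\<in>F. 0 \<le> c v" "x = (\<Sum>v\<in>F. c v *\<^sub>R v)"
    using assms by (auto simp: fin_cone_def)
  define G where "G = {v \<in> F. c v \<noteq> 0}"
  have "finite G" using F(1) by (simp add: G_def)
  have x: "x = (\<Sum>v\<in>G. c v *\<^sub>R v)"
    unfolding F(4) G_def using F(1) by (intro sum.mono_neutral_right) auto
  obtain h where h: "bij_betw h {0..<card G} G"
    using ex_bij_betw_nat_finite[OF \<open>finite G\<close>] by blast
  have hG: "h i \<in> G" if "i \<in> {0..<card G}" for i
    using h that by (rule bij_betw_apply)
  obtain g where g: "\<And>v. v \<in> G \<Longrightarrow> g v \<in> T \<and> f (g v) = v"
  proof (rule that[of "inv_into T f"])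
    fix v assume "v \<in> G"
    then have "v \<in> f ` T" using F(2) by (auto simp: G_def)
    then show "inv_into T f v \<in> T \<and> f (inv_into T f v) = v"
      by (simp add: inv_into_into f_inv_into_f)
  qed
  show thesis
  proof (rule that[of "{0..<card G}" "\<lambda>i. c (h i)" "\<lambda>i. g (h i)"])
    show "c (h i) > 0" if "i \<in> {0..<card G}" for i
      using hG[OF that] F(3) by (auto simp: G_def order_less_le)
    show "g (h i) \<in> T" if "i \<in> {0..<card G}" for i
      using g hG[OF that] by blast
    have "x = (\<Sum>i\<in>{0..<card G}. c (h i) *\<^sub>R h i)"
      unfolding x by (rule sum.reindex_bij_betw[OF h, symmetric])
    also have "\<dots> = (\<Sum>i\<in>{0..<card G}. c (h i) *\<^sub>R f (g (h i)))"
      using g hG by (intro sum.cong) auto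
    finally show "x = (\<Sum>i\<in>{0..<card G}. c (h i) *\<^sub>R f (g (h i)))" .
  qed simp
qed

section \<open>Polarization of outer products\<close>

lemma outer_scaleR: "outer (c *\<^sub>R t) = c\<^sup>2 *\<^sub>R outer t"
  by (simp add: outer_def vec_eq_iff power2_eq_square)

text \<open>With \<open>\<beta>(x,y) = (x + y)(x + y)\<^sup>T - x x\<^sup>T - y y\<^sup>T = x y\<^sup>T + y x\<^sup>T\<close>, the claim holds for the values
  of \<open>\<beta>\<close> on \<open>V\<close> because \<open>x x\<^sup>T\<close> is a quarter of \<open>(x + x)(x + x)\<^sup>T\<close>.  Bilinearity extends it to the
  span of \<open>V\<close>, one argument at a time, and \<open>\<beta>(t,t) = 2 t t\<^sup>T\<close>.\<close>

lemma outer_in_span_outer_sums: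
  fixes t :: "real ^ 'p"
  assumes "t \<in> span V"
  shows "outer t \<in> span {outer (u + v) | u v. u \<in> V \<and> v \<in> V}"
proof -
  let ?W = "span {outer (u + v) | u v. u \<in> V \<and> v \<in> V}"
  define \<beta> :: "real ^ 'p \<Rightarrow> real ^ 'p \<Rightarrow> real ^ 'p ^ 'p"
    where "\<beta> x y = outer (x + y) - outer x - outer y" for x y
  have entries: "\<beta> x y $ i $ j = x $ i * y $ j + y $ i * x $ j" for x y i j
    by (simp add: \<beta>_def outer_def algebra_simps)
  have sym: "\<beta> x y = \<beta> y x" for x y
    by (simp add: vec_eq_iff entries)
  have lin: "linear (\<lambda>x. \<beta> x y)" for y
    by (rule linearI) (simp_all add: vec_eq_iff entries algebra_simps)
  have sub: "subspace {x. \<beta> x y \<in> ?W}" for y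
    using linear_subspace_vimage[OF lin subspace_span] by (simp add: vimage_def)
  have base: "\<beta> u v \<in> ?W" if "u \<in> V" "v \<in> V" for u v
  proof -
    have sum_in: "outer (u' + v') \<in> ?W" if "u' \<in> V" "v' \<in> V" for u' v'
      using that by (intro span_base) auto
    have square_in: "outer w \<in> ?W" if "w \<in> V" for w
    proof -
      have "outer w = (1 / 4) *\<^sub>R outer (w + w)"
        by (simp add: outer_def vec_eq_iff)
      then show ?thesis
        using sum_in[OF that that] by (simp add: span_scale)
    qed
    show ?thesis
      unfolding \<beta>_def using that by (intro span_diff sum_in square_in)
  qed
  have half: "\<beta> x v \<in> ?W" if "x \<in> span V" "v \<in> V" for x v
    by (rule span_induct[OF that(1) sub]) (rule base[OF _ that(2)])
  have "\<beta> x y \<in> ?W" if "x \<in> span V" "y \<in> span V" for x y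
  proof (rule span_induct[OF that(1) sub])
    show "\<beta> v y \<in> ?W" if "v \<in> V" for v
      using half[OF \<open>y \<in> span V\<close> that] by (simp only: sym[of v y])
  qed
  then have "\<beta> t t \<in> ?W" using assms by blast
  moreover have "outer t = (1 / 2) *\<^sub>R \<beta> t t"
    by (simp add: vec_eq_iff entries outer_def)
  ultimately show ?thesis by (simp add: span_scale)
qed

lemma convex_cone_CP: "convex_cone (CP :: (real ^ 'p ^ 'p) set)"
proof -
  have "cone (outer ` (nonneg_vecs :: (real ^ 'p) set))"
  proof (unfold cone_def, intro ballI allI impI)
    fix x :: "real ^ 'p ^ 'p" and c :: real
    assume "x \<in> outer ` nonneg_vecs" "0 \<le> c"
    then obtain t where t: "t \<in> nonneg_vecs" "x = outer t" by blast
    have "c *\<^sub>R x = outer (sqrt c *\<^sub>R t)"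
      using \<open>0 \<le> c\<close> by (simp add: outer_scaleR t(2))
    moreover have "sqrt c *\<^sub>R t \<in> nonneg_vecs"
      using t(1) \<open>0 \<le> c\<close> by (simp add: nonneg_vecs_def)
    ultimately show "c *\<^sub>R x \<in> outer ` nonneg_vecs" by blast
  qed
  then have "cone (CP :: (real ^ 'p ^ 'p) set)"
    unfolding CP_def by (rule cone_convex_hull)
  moreover have "(0 :: real ^ 'p ^ 'p) = outer 0" "(0 :: real ^ 'p) \<in> nonneg_vecs"
    by (simp_all add: outer_def nonneg_vecs_def vec_eq_iff)
  then have "(CP :: (real ^ 'p ^ 'p) set) \<noteq> {}"
    unfolding CP_def by auto
  ultimately show ?thesis
    by (simp add: convex_cone_def CP_def convex_convex_hull conic_def cone_def)
qed

lemma outer_in_CP: "t \<in> nonneg_vecs \<Longrightarrow> outer t \<in> CP"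
  unfolding CP_def by (intro hull_inc imageI)

section \<open>The two conditions in terms of one linear map\<close>

definition coeff_map :: "('n::finite option \<Rightarrow> real ^ 'p ^ 'p) \<Rightarrow> real ^ 'p ^ 'p \<Rightarrow> real ^ 'n option"
  where "coeff_map A U = (\<chi> m. mat_inner (A m) U)"

lemma linear_coeff_map: "linear (coeff_map A)"
  by (rule linearI)
    (simp_all add: coeff_map_def vec_eq_iff mat_inner_def trace_def matrix_matrix_mult_def
      algebra_simps sum.distrib sum_distrib_left)

lemma coeff_map_outer: "coeff_map A (outer t) = a_vec A t"
  by (simp add: coeff_map_def a_vec_def vec_eq_iff mat_inner_def trace_def outer_def
      matrix_matrix_mult_def matrix_vector_mult_def inner_vec_def sum_distrib_left mult_ac)

lemma coeff_map_eq_0_iff: "coeff_map A U = 0 \<longleftrightarrow> (\<forall>m. mat_inner (A m) U = 0)"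
  by (simp add: coeff_map_def vec_eq_iff)

lemma ordered_pairs_subset: "ordered_pairs xs \<subseteq> set xs \<times> set xs"
  by (auto simp: ordered_pairs_def)

lemma finite_ordered_pairs: "finite (ordered_pairs xs)"
  by (rule finite_subset[OF ordered_pairs_subset]) simp

text \<open>Each unordered pair, the diagonal included, is listed in at least one of its two orders.\<close>

lemma ordered_pairs_total:
  assumes "l \<in> set xs" "q \<in> set xs"
  shows "(l, q) \<in> ordered_pairs xs \<or> (q, l) \<in> ordered_pairs xs"
proof -
  obtain i j where "i < length xs" "xs ! i = l" "j < length xs" "xs ! j = q"
    using assms by (meson in_set_conv_nth)
  then show ?thesis
    unfolding ordered_pairs_def using nat_le_linear[of i j] by blast
qed

theorem proposition6:
  fixes A :: "'n::finite option \<Rightarrow> real ^ 'p ^ 'p"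
    and J :: "'j set" and \<tau> :: "'j \<Rightarrow> real ^ 'p"
    and S :: "'s set" and JS :: "'s \<Rightarrow> 'j set" and num :: "'s \<Rightarrow> 'j list"
  assumes "CARD('p) > 1"
    and "\<And>m. A m \<in> sym_mats"
    and "feasible A \<noteq> {}"
    and "finite J"
    and "bij_betw \<tau> J {v. v extreme_point_of (convex hull (T_im A))}"
    and "finite S"
    and "\<And>s. s \<in> S \<Longrightarrow> JS s \<subseteq> J"
    and "T_im A = (\<Union>s\<in>S. convex hull (\<tau> ` JS s))"
    and "\<And>s j. s \<in> S \<Longrightarrow> j \<in> JS s \<Longrightarrow> (\<Union>i\<in>JS s. {k. \<tau> i $ k > 0}) \<subseteq> M_set A (\<tau> j)"
    and "\<And>s. s \<in> S \<Longrightarrow> distinct (num s) \<and> set (num s) = JS s"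
  shows "subspace (fin_cone (a_vec A ` T_im A)) \<longleftrightarrow>
    (\<exists>U\<in>CP. (\<exists>(I :: nat set) \<alpha> t. finite I \<and> (\<forall>i\<in>I. \<alpha> i > 0 \<and> t i \<in> T_im A) \<and>
          U = (\<Sum>i\<in>I. \<alpha> i *\<^sub>R outer (t i)) +
              (1 / 4) *\<^sub>R (\<Sum>(l, q)\<in>(\<Union>s\<in>S. ordered_pairs (num s)). outer (\<tau> l + \<tau> q))) \<and>
        (\<forall>m. mat_inner (A m) U = 0))"
proof -
  let ?T = "T_im A" and ?E = "\<Union>s\<in>S. ordered_pairs (num s)"
  let ?L = "fin_cone (a_vec A ` ?T)"
  define \<mu> where "\<mu> = (\<lambda>(l, q). (1 / 2) *\<^sub>R (\<tau> l + \<tau> q))"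
  have set_num: "set (num s) = JS s" if "s \<in> S" for s
    using assms(10)[OF that] by simp
  have finE: "finite ?E"
    using assms(6) by (simp add: finite_ordered_pairs)
  have \<mu>_T: "\<mu> e \<in> ?T" if "e \<in> ?E" for e
  proof -
    obtain s where s: "s \<in> S" "e \<in> ordered_pairs (num s)"
      using \<open>e \<in> ?E\<close> by blast
    then obtain l q where e: "e = (l, q)" "l \<in> JS s" "q \<in> JS s"
      using ordered_pairs_subset[of "num s"] set_num[OF s(1)] by (cases e) auto
    then have "(1 / 2) *\<^sub>R \<tau> l + (1 / 2) *\<^sub>R \<tau> q \<in> convex hull (\<tau> ` JS s)"
      by (intro convexD[OF convex_convex_hull] hull_inc imageI) auto
    then have "\<mu> e \<in> convex hull (\<tau> ` JS s)"
      by (simp add: \<mu>_def e(1) scaleR_right_distrib)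
    with s(1) assms(8) show ?thesis by blast
  qed
  have midpoints: "(1 / 4) *\<^sub>R (\<Sum>(l, q)\<in>?E. outer (\<tau> l + \<tau> q)) = (\<Sum>e\<in>?E. outer (\<mu> e))"
    unfolding scaleR_sum_right
    by (intro sum.cong) (auto simp: \<mu>_def outer_scaleR power2_eq_square)
  have a_T: "a_vec A t \<in> ?L" if "t \<in> ?T" for t
    using that by (intro subsetD[OF subset_fin_cone] imageI)
  have coeff_map_U: "coeff_map A ((\<Sum>i\<in>I. \<alpha> i *\<^sub>R outer (t i)) + (\<Sum>e\<in>?E. outer (\<mu> e)))
      = (\<Sum>i\<in>I. \<alpha> i *\<^sub>R a_vec A (t i)) + (\<Sum>e\<in>?E. a_vec A (\<mu> e))"
    for I :: "nat set" and \<alpha> t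
    by (simp add: linear_add[OF linear_coeff_map] linear_sum[OF linear_coeff_map]
        linear_scale[OF linear_coeff_map] coeff_map_outer)
  show ?thesis
    unfolding midpoints coeff_map_eq_0_iff[symmetric]
  proof
    assume L: "subspace ?L"
    have "(\<Sum>e\<in>?E. a_vec A (\<mu> e)) \<in> ?L"
      by (intro subspace_sum[OF L] a_T \<mu>_T)
    then have "- (\<Sum>e\<in>?E. a_vec A (\<mu> e)) \<in> ?L"
      by (rule subspace_neg[OF L])
    then obtain I :: "nat set" and \<alpha> t where I: "finite I" "\<And>i. i \<in> I \<Longrightarrow> \<alpha> i > 0"
      "\<And>i. i \<in> I \<Longrightarrow> t i \<in> ?T" "- (\<Sum>e\<in>?E. a_vec A (\<mu> e)) = (\<Sum>i\<in>I. \<alpha> i *\<^sub>R a_vec A (t i))"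
      by (rule fin_cone_image_positive) blast
    define U where "U = (\<Sum>i\<in>I. \<alpha> i *\<^sub>R outer (t i)) + (\<Sum>e\<in>?E. outer (\<mu> e))"
    have "coeff_map A U = 0"
      unfolding U_def coeff_map_U I(4)[symmetric] by simp
    moreover have "U \<in> CP"
    proof -
      have "outer v \<in> CP" if "v \<in> ?T" for v
        using that by (auto simp: T_im_def std_simplex_def intro: outer_in_CP)
      then show ?thesis
        unfolding U_def using I(2,3) \<mu>_T
        by (intro convex_cone_add[OF convex_cone_CP] convex_cone_sum[OF convex_cone_CP]
            convex_cone_scaleR[OF convex_cone_CP]) (auto simp: less_imp_le)
    qed
    ultimately show "\<exists>U\<in>CP. (\<exists>(I :: nat set) \<alpha> t. finite I \<and> (\<forall>i\<in>I. \<alpha> i > 0 \<and> t i \<in> ?T) \<and>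
        U = (\<Sum>i\<in>I. \<alpha> i *\<^sub>R outer (t i)) + (\<Sum>e\<in>?E. outer (\<mu> e))) \<and> coeff_map A U = 0"
      using I(1-3) U_def by (intro bexI[of _ U] conjI exI[of _ I] exI[of _ \<alpha>] exI[of _ t]) auto
  next
    assume "\<exists>U\<in>CP. (\<exists>(I :: nat set) \<alpha> t. finite I \<and> (\<forall>i\<in>I. \<alpha> i > 0 \<and> t i \<in> ?T) \<and>
        U = (\<Sum>i\<in>I. \<alpha> i *\<^sub>R outer (t i)) + (\<Sum>e\<in>?E. outer (\<mu> e))) \<and> coeff_map A U = 0"
    then obtain I :: "nat set" and \<alpha> t where I: "\<forall>i\<in>I. \<alpha> i > 0 \<and> t i \<in> ?T"
      and rel: "(\<Sum>i\<in>I. \<alpha> i *\<^sub>R a_vec A (t i)) + (\<Sum>e\<in>?E. a_vec A (\<mu> e)) = 0"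
      using coeff_map_U by auto
    let ?N = "{v. v \<in> ?L \<and> - v \<in> ?L}"
    have N: "subspace ?N"
      by (rule subspace_lineality[OF convex_cone_fin_cone])
    have "(\<Sum>i\<in>I. \<alpha> i *\<^sub>R a_vec A (t i)) \<in> ?L"
      using I by (intro convex_cone_sum[OF convex_cone_fin_cone]
          convex_cone_scaleR[OF convex_cone_fin_cone] a_T) (auto simp: less_imp_le)
    then have \<mu>_N: "a_vec A (\<mu> e) \<in> ?N" if "e \<in> ?E" for e
      using neg_summand_in_convex_cone[OF convex_cone_fin_cone _ finE a_T[OF \<mu>_T] rel that]
        a_T[OF \<mu>_T[OF that]] by simp
    have "- a_vec A u \<in> ?L" if "u \<in> ?T" for u
    proof -
      obtain s where s: "s \<in> S" "u \<in> convex hull (\<tau> ` JS s)"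
        using \<open>u \<in> ?T\<close> unfolding assms(8) by auto
      let ?G = "{outer (v + w) | v w. v \<in> \<tau> ` JS s \<and> w \<in> \<tau> ` JS s}"
      have "u \<in> span (\<tau> ` JS s)"
        by (rule subsetD[OF convex_hull_subset_span s(2)])
      then have "outer u \<in> span ?G"
        by (rule outer_in_span_outer_sums)
      moreover have "?G \<subseteq> coeff_map A -` ?N"
      proof clarify
        fix l q assume lq: "l \<in> JS s" "q \<in> JS s"
        (* the sum is symmetric, so the order in which the pair is listed is irrelevant *)
        obtain e where e: "e \<in> ?E" "\<tau> l + \<tau> q = 2 *\<^sub>R \<mu> e"
        proof (cases "(l, q) \<in> ordered_pairs (num s)")
          case True
          then show ?thesis
            using s(1) by (intro that[of "(l, q)"]) (auto simp: \<mu>_def)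
        next
          case False
          then have "(q, l) \<in> ordered_pairs (num s)"
            using ordered_pairs_total[of l "num s" q] lq set_num[OF s(1)] by simp
          then show ?thesis
            using s(1) by (intro that[of "(q, l)"]) (auto simp: \<mu>_def add.commute)
        qed
        have "coeff_map A (outer (\<tau> l + \<tau> q)) = 4 *\<^sub>R a_vec A (\<mu> e)"
          unfolding e(2) outer_scaleR by (simp add: linear_scale[OF linear_coeff_map] coeff_map_outer)
        moreover have "4 *\<^sub>R a_vec A (\<mu> e) \<in> ?N"
          by (rule subspace_scale[OF N \<mu>_N[OF e(1)]])
        ultimately show "outer (\<tau> l + \<tau> q) \<in> coeff_map A -` ?N"
          by (simp only: vimage_eq)
      qed
      then have "span ?G \<subseteq> coeff_map A -` ?N"
        by (rule span_minimal) (rule linear_subspace_vimage[OF linear_coeff_map N])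
      ultimately have "outer u \<in> coeff_map A -` ?N" by (rule subsetD[rotated])
      then show ?thesis by (simp add: coeff_map_outer)
    qed
    then show "subspace ?L"
      by (intro subspace_fin_coneI) auto
  qed
qed

end
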